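(* Let $K$ be a compact line and $Q$ a subset of $K$. If $Q$, endowed with the topology induced by $K$, admits a countably separating family, then every weak*-null family $(F_i)_{i\in I}$ in $\mathrm{NBV}(K)$ is of type $c_0\ell_1$ over $Q$.
   Context: A compact line is a totally ordered set which is compact in its order topology. $\mathrm{NBV}(K)$ is the space of right-continuous real maps of bounded variation on $K$, identified with $C(K)^*$ via $F_\mu(t)=\mu([\min K,t])$. $\lim_{i\in I}a_i=0$ means $\{i:|a_i|\ge\varepsilon\}$ is finite for every $\varepsilon>0$. A family $(F_i)_{i\in I}$ in $\mathrm{NBV}(K)$ is weak*-null if $\lim_{i\in I}\int_Kf\,d\mu_i=0$ for every $f\in C(K)$, $\mu_i$ being the measure associated to $F_i$. $(F_i)$ is of type $c_0\ell_1$ over $Q$ if $F_i(t)=a_{i,t}+b_{i,t}$ ($i\in I$, $t\in Q$) with $\lim_{i\in I}a_{i,t}=0$ for each $t\in Q$ and $\sup_{i}\sum_{t\in Q}|b_{i,t}|<\infty$. A countably separating family for a topological space $X$ is a family $(V_x)_{x\in X}$ with $V_x$ a neighborhood of $x$ for each $x$, such that every subset $M\subseteq X$ satisfying $x\in V_y$ for all $x,y\in M$ is countable. *)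

theory Defs
  imports "HOL-Analysis.Analysis"
begin

text \<open>The compact line K is the whole type 'k, of class linorder_topology
  (order topology), assumed compact.  The index set I is the whole type 'i.\<close>

definition lim_zero :: "('i \<Rightarrow> real) \<Rightarrow> bool" where
  "lim_zero a \<longleftrightarrow> (\<forall>e>0. finite {i. e \<le> \<bar>a i\<bar>})"

definition chain_variation :: "('k::linorder \<Rightarrow> real) \<Rightarrow> 'k list \<Rightarrow> real" where
  "chain_variation F ts = (\<Sum>k < length ts - 1. \<bar>F (ts ! Suc k) - F (ts ! k)\<bar>)"

definition bounded_variation :: "('k::linorder \<Rightarrow> real) \<Rightarrow> bool" where
  "bounded_variation F \<longleftrightarrow> (\<exists>C. \<forall>ts. sorted ts \<longrightarrow> chain_variation F ts \<le> C)"

definition NBV :: "('k::linorder_topology \<Rightarrow> real) set" where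
  "NBV = {F. (\<forall>t. (F \<longlongrightarrow> F t) (at_right t)) \<and> bounded_variation F}"

definition radon :: "'k::topological_space measure \<Rightarrow> bool" where
  "radon M \<longleftrightarrow> sets M = sets borel \<and> finite_measure M \<and>
     (\<forall>A\<in>sets M. emeasure M A = (SUP C\<in>{C. compact C \<and> C \<subseteq> A}. emeasure M C))"

text \<open>The signed Radon measure mp - mn is the measure associated to F,
  i.e. F(t) = mu([min K, t]) for all t.\<close>
definition assoc_measure ::
  "('k::linorder_topology \<Rightarrow> real) \<Rightarrow> 'k measure \<Rightarrow> 'k measure \<Rightarrow> bool" where
  "assoc_measure F mp mn \<longleftrightarrow> radon mp \<and> radon mn \<and>
     (\<forall>t. F t = measure mp {..t} - measure mn {..t})"

definition signed_integral :: "'k measure \<Rightarrow> 'k measure \<Rightarrow> ('k \<Rightarrow> real) \<Rightarrow> real" where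
  "signed_integral mp mn f = integral\<^sup>L mp f - integral\<^sup>L mn f"

definition weak_star_null ::
  "('i \<Rightarrow> 'k::topological_space \<Rightarrow> real) \<Rightarrow> ('i \<Rightarrow> 'k measure) \<Rightarrow> ('i \<Rightarrow> 'k measure) \<Rightarrow> bool" where
  "weak_star_null F mp mn \<longleftrightarrow>
     (\<forall>f::'k \<Rightarrow> real. continuous_on UNIV f \<longrightarrow>
        lim_zero (\<lambda>i. signed_integral (mp i) (mn i) f))"

definition type_c0l1 :: "('i \<Rightarrow> 'k \<Rightarrow> real) \<Rightarrow> 'k set \<Rightarrow> bool" where
  "type_c0l1 F Q \<longleftrightarrow> (\<exists>a b. (\<forall>i. \<forall>t\<in>Q. F i t = a i t + b i t) \<and>
     (\<forall>t\<in>Q. lim_zero (\<lambda>i. a i t)) \<and>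
     (\<exists>C. \<forall>i. \<forall>S. finite S \<and> S \<subseteq> Q \<longrightarrow> (\<Sum>t\<in>S. \<bar>b i t\<bar>) \<le> C))"

definition countably_separating :: "'k::topological_space set \<Rightarrow> ('k \<Rightarrow> 'k set) \<Rightarrow> bool" where
  "countably_separating Q V \<longleftrightarrow>
     (\<forall>x\<in>Q. V x \<subseteq> Q \<and> (\<exists>U. open U \<and> x \<in> U \<and> U \<inter> Q \<subseteq> V x)) \<and>
     (\<forall>M. M \<subseteq> Q \<and> (\<forall>x\<in>M. \<forall>y\<in>M. x \<in> V y) \<longrightarrow> countable M)"

end

theory Submission
  imports Defs
begin

text \<open>
A weak*-null family is bounded, and testing against a monotone continuous step from 1 to 0 between
s and t shows that, for all but finitely many i, the function F i comes close to zero or changes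
sign on [s, t).
This has three consequences. For finite S, the sum of |F i| over S is at most 2C+1 for all but
finitely many i. Each t has only countably many irregular i, and the sum of |F i| over points at
which i is regular is at most 3C. For each i, apart from finitely many i per point t and threshold,
F i is large only at points around which it oscillates on both sides; since F i has bounded
variation, these points split into countably many classes of mutually close points, and these
classes are countable by separation.
Thus the irregular pairs (i, t) form a bipartite graph with countable degrees. Its components are
countable, and on each of them the decomposition is made greedily along an enumeration.\<close>

section \<open>Uniform boundedness and monotone Urysohn functions\<close>

text \<open>By Baire, one of the closed sets \<open>E n\<close> contains a ball around some
  \<open>z\<close>. On vectors \<open>y\<close> of norm \<open>r\<close>, \<open>T i y\<close> is
  the difference of two values bounded by \<open>n\<close>, and scaling gives the bound.
  Completeness is a hypothesis on \<open>UNIV\<close> rather than a class constraint, so that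
  \<open>complete_UNIV_bcontfun\<close> can supply it.\<close>

lemma uniform_boundedness:
  fixes T :: "'i \<Rightarrow> 'a::real_normed_vector \<Rightarrow> 'b::real_normed_vector"
  assumes complete: "complete (UNIV :: 'a set)"
    and lin: "\<And>i. bounded_linear (T i)"
    and ptw: "\<And>x. \<exists>B. \<forall>i. norm (T i x) \<le> B"
  shows "\<exists>B. \<forall>i x. norm (T i x) \<le> B * norm x"
proof -
  define E where "E n = {x. \<forall>i. norm (T i x) \<le> real n}" for n
  have closed: "closed (E n)" for n
  proof -
    have "E n = (\<Inter>i. {x. norm (T i x) \<le> real n})"
      by (auto simp: E_def)
    then show ?thesis
      by (auto intro!: closed_INT closed_Collect_le continuous_on_norm
          bounded_linear.continuous_on[OF lin] continuous_on_id continuous_on_const)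
  qed
  have "(\<Union>n. E n) = UNIV"
  proof (intro equalityI subset_UNIV subsetI)
    fix x
    obtain B where "\<forall>i. norm (T i x) \<le> B" using ptw by blast
    moreover obtain n where "B \<le> real n" using real_arch_simple by blast
    ultimately have "x \<in> E n" unfolding E_def using order_trans by blast
    then show "x \<in> (\<Union>n. E n)" by blast
  qed
  moreover have "interior (\<Union>(range E)) = {}" if "\<And>n. interior (E n) = {}"
    using Met_TC.metric_Baire_category_alt[of "range E"] complete closed that by auto
  ultimately have "\<exists>n. interior (E n) \<noteq> {}"
    by fastforce
  then obtain n z r where r: "0 < r" "cball z r \<subseteq> E n"
    using mem_interior_cball by (metis ex_in_conv)
  have "norm (T i x) \<le> (2 * real n / r) * norm x" for i x
  proof (cases "x = 0")
    case True
    then show ?thesis by (simp add: linear_simps lin)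
  next
    case False
    define y where "y = (r / norm x) *\<^sub>R x"
    have "norm y = r" using False r by (simp add: y_def)
    then have "z + y \<in> cball z r" "z \<in> cball z r" using r by (auto simp: dist_norm)
    then have "norm (T i (z + y)) \<le> real n" "norm (T i z) \<le> real n"
      using r unfolding E_def by blast+
    then have "norm (T i (z + y) - T i z) \<le> 2 * real n"
      using norm_triangle_ineq4[of "T i (z + y)" "T i z"] by linarith
    moreover have "T i (z + y) - T i z = (r / norm x) *\<^sub>R T i x"
      by (simp add: y_def linear_simps lin)
    ultimately have "r / norm x * norm (T i x) \<le> 2 * real n"
      using r by simp
    then show ?thesis using False r by (simp add: field_simps)
  qed
  then show ?thesis by blast
qed

text \<open>The library has this only over a metric domain.\<close>

lemma complete_UNIV_bcontfun:
  "complete (UNIV :: ('a::topological_space \<Rightarrow>\<^sub>C 'b::complete_space) set)"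
  unfolding complete_def
proof (intro allI impI)
  fix f :: "nat \<Rightarrow> 'a \<Rightarrow>\<^sub>C 'b"
  assume "(\<forall>n. f n \<in> UNIV) \<and> Cauchy f"
  then have "Cauchy f" by simp
  have "uniformly_Cauchy_on UNIV (\<lambda>n. apply_bcontfun (f n))"
  proof (rule uniformly_Cauchy_onI)
    fix e :: real assume "0 < e"
    then obtain M where "\<forall>m\<ge>M. \<forall>n\<ge>M. dist (f m) (f n) < e"
      using \<open>Cauchy f\<close> unfolding Cauchy_def by blast
    then show "\<exists>M. \<forall>x\<in>UNIV. \<forall>m\<ge>M. \<forall>n\<ge>M. dist (f m x) (f n x) < e"
      using dist_fun_lt_imp_dist_val_lt by blast
  qed
  then obtain g where "uniform_limit UNIV (\<lambda>n. apply_bcontfun (f n)) g sequentially"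
    using Cauchy_uniformly_convergent unfolding uniformly_convergent_on_def by blast
  then show "\<exists>l\<in>UNIV. f \<longlonglongrightarrow> l"
    using uniform_limit_bcontfunE[OF _ sequentially_bot] by blast
qed

text \<open>If \<open>f\<close> stays within \<open>e\<close> of \<open>f x\<close> on
  \<open>{u..v}\<close>, then passing from \<open>u\<close> to \<open>v\<close> only adds values
  that are at least \<open>f u - 2 * e\<close>, so the infimum drops by at most
  \<open>2 * e\<close>.\<close>

lemma running_inf_continuous:
  fixes f :: "'k::linorder_topology \<Rightarrow> real"
  assumes cont: "continuous_on UNIV f" and lower: "\<And>x. 0 \<le> f x"
  shows "continuous_on UNIV (\<lambda>x. INF y\<in>{..x}. f y)"
proof -
  define m where "m x = (INF y\<in>{..x}. f y)" for x
  have bdd: "bdd_below (f ` A)" for A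
    using lower by (auto intro!: bdd_belowI[of _ 0])
  have m_le: "m x \<le> f y" if "y \<le> x" for x y
    unfolding m_def using that bdd by (auto intro: cINF_lower)
  have m_ge: "c \<le> m x" if "\<And>y. y \<le> x \<Longrightarrow> c \<le> f y" for x c
    unfolding m_def using that by (intro cINF_greatest) auto
  have near: "\<bar>m u - m v\<bar> \<le> 2 * e"
    if uv: "u \<le> v" and x: "\<And>z. z \<in> {u..v} \<Longrightarrow> \<bar>f z - f x\<bar> < e" for u v x e
  proof -
    have "m v \<le> m u" using uv by (intro m_ge m_le) auto
    moreover have "m u - 2 * e \<le> m v"
    proof (rule m_ge)
      fix y assume "y \<le> v"
      have e: "0 < e" using x[of u] uv by force
      show "m u - 2 * e \<le> f y"
      proof (cases "y \<le> u")
        case True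
        then show ?thesis using m_le[of y u] e by simp
      next
        case False
        then show ?thesis
          using m_le[of u u] x[of u] x[of y] uv \<open>y \<le> v\<close> by force
      qed
    qed
    ultimately show ?thesis by linarith
  qed
  have "(m \<longlongrightarrow> m x) (at x)" for x
  proof (rule tendstoI)
    fix e :: real assume "0 < e"
    have fx: "(f \<longlongrightarrow> f x) (at x)"
      using cont by (simp add: continuous_on_def)
    then have fx': "(f \<longlongrightarrow> f x) (nhds x)"
      by (simp add: tendsto_at_iff_tendsto_nhds)
    have "\<forall>\<^sub>F y in nhds x. dist (f y) (f x) < e / 3"
      using fx' \<open>0 < e\<close> by (intro tendstoD) auto
    then obtain U where U: "open U" "x \<in> U" "\<And>y. y \<in> U \<Longrightarrow> \<bar>f y - f x\<bar> < e / 3"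
      by (auto simp: eventually_nhds dist_real_def)
    \<comment> \<open>For \<open>y\<close> near \<open>x\<close> the whole interval between them has
      to stay in \<open>U\<close>. The two sides are treated separately because \<open>x\<close> may
      be an endpoint of the line; the interval on that side is then at most \<open>{x}\<close>, and
      \<open>UNIV\<close> serves.\<close>
    have "\<exists>W. open W \<and> x \<in> W \<and> (\<forall>y\<in>W. {min x y..max x y} \<subseteq> U)"
    proof -
      have "\<exists>R. open R \<and> x \<in> R \<and> (\<forall>y\<in>R. {x..y} \<subseteq> U)"
      proof (cases "\<exists>y. x < y")
        case True
        then obtain b where "b > x" "{x..<b} \<subseteq> U" using open_right[OF U(1,2)] by blast
        then show ?thesis by (intro exI[of _ "{..<b}"]) force
      next
        case False
        then show ?thesis using U(2) by (intro exI[of _ UNIV]) (auto, metis antisym not_le)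
      qed
      then obtain R where R: "open R" "x \<in> R" "\<forall>y\<in>R. {x..y} \<subseteq> U" by blast
      have "\<exists>L. open L \<and> x \<in> L \<and> (\<forall>y\<in>L. {y..x} \<subseteq> U)"
      proof (cases "\<exists>y. y < x")
        case True
        then obtain b where "b < x" "{b<..x} \<subseteq> U" using open_left[OF U(1,2)] by blast
        then show ?thesis by (intro exI[of _ "{b<..}"]) force
      next
        case False
        then show ?thesis using U(2) by (intro exI[of _ UNIV]) (auto, metis antisym not_le)
      qed
      then obtain L where L: "open L" "x \<in> L" "\<forall>y\<in>L. {y..x} \<subseteq> U" by blast
      show ?thesis
        using R L by (intro exI[of _ "R \<inter> L"]) (auto simp: min_def max_def)
    qed
    then obtain W where W: "open W" "x \<in> W" "\<And>y. y \<in> W \<Longrightarrow> {min x y..max x y} \<subseteq> U"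
      by blast
    have "dist (m y) (m x) < e" if "y \<in> W" for y
    proof -
      have "\<bar>m (min x y) - m (max x y)\<bar> \<le> 2 * (e / 3)"
        using W(3)[OF that] U(3) by (intro near[of _ _ x]) (auto simp: min_le_iff_disj)
      then have "\<bar>m x - m y\<bar> \<le> 2 * (e / 3)"
        by (cases "x \<le> y") (simp_all add: min_def max_def abs_minus_commute)
      then show ?thesis using \<open>0 < e\<close> by (simp add: dist_real_def abs_minus_commute)
    qed
    then show "\<forall>\<^sub>F y in at x. dist (m y) (m x) < e"
      using W(1,2) by (auto simp: eventually_at_topological)
  qed
  then show ?thesis unfolding m_def continuous_on_def by simp
qed

text \<open>The running infimum of an ordinary Urysohn function is monotone and, on a line, still
  continuous.\<close>

lemma Urysohn_antimono:
  fixes s t :: "'k::linorder_topology"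
  assumes "compact (UNIV :: 'k set)" "s < t"
  obtains f :: "'k \<Rightarrow> real" where "continuous_on UNIV f" "antimono f" "\<And>x. f x \<in> {0..1}"
    "\<And>x. x \<le> s \<Longrightarrow> f x = 1" "\<And>x. t \<le> x \<Longrightarrow> f x = 0"
proof -
  have "Hausdorff_space (euclidean :: 'k topology)"
    unfolding Hausdorff_space_def using hausdorff by (fastforce simp: disjnt_def)
  moreover have "compact_space (euclidean :: 'k topology)"
    using assms(1) by (simp add: compact_space_def)
  ultimately have "normal_space (euclidean :: 'k topology)"
    by (simp add: compact_Hausdorff_or_regular_imp_normal_space)
  then obtain g where g: "continuous_map (euclidean :: 'k topology) (top_of_set {0..1::real}) g"
    "g ` {t..} \<subseteq> {0}" "g ` {..s} \<subseteq> {1}"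
    by (rule Urysohn_lemma[of _ "{t..}" "{..s}" 0 1]) (use assms(2) in \<open>auto simp: disjnt_def\<close>)
  have g01: "g x \<in> {0..1}" and contg: "continuous_on UNIV g" for x
    using g(1) by (auto simp: continuous_map_in_subtopology)
  define f where "f x = (INF y\<in>{..x}. g y)" for x
  have bdd: "bdd_below (g ` A)" for A
    using g01 by (auto intro!: bdd_belowI[of _ 0])
  have f_le: "f x \<le> g y" if "y \<le> x" for x y
    unfolding f_def using that bdd by (auto intro: cINF_lower)
  have f_ge: "c \<le> f x" if "\<And>y. y \<le> x \<Longrightarrow> c \<le> g y" for x c
    unfolding f_def using that by (intro cINF_greatest) auto
  show ?thesis
  proof (rule that[of f])
    show "continuous_on UNIV f"
      unfolding f_def using contg g01 by (intro running_inf_continuous) auto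
    show "antimono f"
      by (intro antimonoI f_ge f_le) auto
    show f01: "f x \<in> {0..1}" for x
      using f_ge[of x 0] f_le[of x x] g01 by (auto intro: order_trans)
    show "f x = 1" if "x \<le> s" for x
    proof -
      have "1 \<le> g y" if "y \<le> x" for y
        using g(3) order_trans[OF that \<open>x \<le> s\<close>] by (auto simp: image_subset_iff)
      then have "1 \<le> f x" by (rule f_ge)
      with f01[of x] show ?thesis by simp
    qed
    show "f x = 0" if "t \<le> x" for x
    proof -
      have "f x \<le> 0" using that g(2) f_le[of x x] by force
      with f01[of x] show ?thesis by simp
    qed
  qed
qed

section \<open>Families of functions of bounded variation on a linear order\<close>

lemma chain_variation_Cons:
  "chain_variation f (x # y # ts) = \<bar>f y - f x\<bar> + chain_variation f (y # ts)"
proof -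
  have "length (x # y # ts) - 1 = Suc (length (y # ts) - 1)"
    by simp
  then show ?thesis
    unfolding chain_variation_def by (simp only: sum.lessThan_Suc_shift) simp
qed

lemma chain_variation_single [simp]: "chain_variation f [x] = 0"
  by (simp add: chain_variation_def)

text \<open>A fixed sign is demanded, not just \<open>e \<le> \<bar>f x\<bar>\<close>: the functions
  may jump across zero, and only a constant sign prevents cancellation in the integral of a monotone
  step.\<close>

definition avoids_zero :: "('k \<Rightarrow> real) \<Rightarrow> 'k set \<Rightarrow> real \<Rightarrow> bool" where
  "avoids_zero f A e \<longleftrightarrow> (\<forall>x\<in>A. e \<le> f x) \<or> (\<forall>x\<in>A. f x \<le> - e)"

text \<open>The witness is chosen according to the sign of \<open>f t\<close>: it lies below
  \<open>e\<close> if \<open>f t\<close> is nonnegative and above \<open>- e\<close> otherwise. Thus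
  the size of \<open>f t\<close> is paid for by an increment, up to \<open>e\<close>.\<close>

lemma not_avoids_zeroE:
  assumes "\<not> avoids_zero f A e"
  obtains x where "x \<in> A" "\<bar>f t\<bar> \<le> \<bar>f t - f x\<bar> + e"
proof (cases "0 \<le> f t")
  case True
  from assms obtain x where "x \<in> A" "f x < e"
    by (auto simp: avoids_zero_def not_le)
  with True show ?thesis by (intro that[of x]) auto
next
  case False
  from assms obtain x where "x \<in> A" "- e < f x"
    by (auto simp: avoids_zero_def not_le)
  with False show ?thesis by (intro that[of x]) auto
qed

text \<open>Each point except the largest pays for its value by the increment to some
  \<open>y\<close> before the next point of \<open>S\<close>. These increments do not overlap, so
  they fit into one chain; the largest point costs \<open>B\<close>. The chain is made to start at
  \<open>Min S\<close> so that the induction can prepend a new minimum and its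
  \<open>y\<close>.\<close>

lemma sum_le_chain_variation:
  fixes f :: "'k::linorder \<Rightarrow> real"
  assumes "finite S" "S \<noteq> {}" "0 \<le> c" "\<And>s. s \<in> S \<Longrightarrow> \<bar>f s\<bar> \<le> B"
    and "\<And>s t. s \<in> S \<Longrightarrow> t \<in> S \<Longrightarrow> s < t \<Longrightarrow> \<exists>y\<in>{s..t}. \<bar>f s\<bar> \<le> c * \<bar>f s - f y\<bar> + d"
    and "0 \<le> d"
  shows "\<exists>ts. sorted (Min S # ts) \<and>
    (\<Sum>s\<in>S. \<bar>f s\<bar>) \<le> B + real (card S) * d + c * chain_variation f (Min S # ts)"
  using assms(1,2,4,5)
proof (induction S rule: finite_linorder_min_induct)
  case empty
  then show ?case by simp
next
  case (insert s S)
  have min: "Min (insert s S) = s"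
    using insert.hyps by (intro Min_eqI) auto
  have notin: "s \<notin> S"
    using insert.hyps by auto
  show ?case
  proof (cases "S = {}")
    case True
    then show ?thesis
      using insert.prems(2)[of s] \<open>0 \<le> d\<close> by (intro exI[of _ "[]"]) auto
  next
    case False
    have "\<exists>ts. sorted (Min S # ts) \<and>
        (\<Sum>s\<in>S. \<bar>f s\<bar>) \<le> B + real (card S) * d + c * chain_variation f (Min S # ts)"
      using False insert.prems(2,3) by (intro insert.IH) auto
    then obtain ts where ts: "sorted (Min S # ts)"
      "(\<Sum>s\<in>S. \<bar>f s\<bar>) \<le> B + real (card S) * d + c * chain_variation f (Min S # ts)"
      by blast
    have "Min S \<in> S" using False insert.hyps by simp
    then obtain y where y: "s \<le> y" "y \<le> Min S" "\<bar>f s\<bar> \<le> c * \<bar>f s - f y\<bar> + d"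
      using insert.prems(3)[of s "Min S"] insert.hyps by auto
    have "c * chain_variation f (s # y # Min S # ts)
        = c * \<bar>f s - f y\<bar> + c * \<bar>f (Min S) - f y\<bar> + c * chain_variation f (Min S # ts)"
      by (simp add: chain_variation_Cons algebra_simps abs_minus_commute)
    moreover have "0 \<le> c * \<bar>f (Min S) - f y\<bar>"
      using \<open>0 \<le> c\<close> by simp
    moreover have "(\<Sum>s\<in>insert s S. \<bar>f s\<bar>) = \<bar>f s\<bar> + (\<Sum>s\<in>S. \<bar>f s\<bar>)"
      "real (card (insert s S)) * d = d + real (card S) * d"
      using insert.hyps(1) notin by (auto simp: algebra_simps)
    ultimately have "(\<Sum>s\<in>insert s S. \<bar>f s\<bar>)
        \<le> B + real (card (insert s S)) * d + c * chain_variation f (s # y # Min S # ts)"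
      using ts(2) y(3) by linarith
    moreover have "sorted (s # y # Min S # ts)"
      using ts(1) y by auto
    ultimately show ?thesis
      unfolding min by blast
  qed
qed

text \<open>If the union were uncountable, some index would have its u below those of infinitely many
  other indices; all of these would then lie in the finite set G u.\<close>

lemma countable_UN_decreasing:
  fixes G :: "'k::linorder \<Rightarrow> 'i set"
  assumes fin: "\<And>u. u \<in> U \<Longrightarrow> finite (G u)"
    and decr: "\<And>u v. u \<le> v \<Longrightarrow> G v \<subseteq> G u"
  shows "countable (\<Union>u\<in>U. G u)"
proof (rule ccontr)
  assume unc: "uncountable (\<Union>u\<in>U. G u)"
  then have "infinite (\<Union>u\<in>U. G u)"
    using countable_finite by blast
  then obtain J where J: "J \<subseteq> (\<Union>u\<in>U. G u)" "countable J" "infinite J"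
    using infinite_countable_subset' by blast
  have "\<forall>j\<in>J. \<exists>u\<in>U. j \<in> G u"
    using J(1) by blast
  then obtain u where u: "\<And>j. j \<in> J \<Longrightarrow> u j \<in> U" "\<And>j. j \<in> J \<Longrightarrow> j \<in> G (u j)"
    by metis
  have "countable (\<Union>j\<in>J. G (u j))"
    using J(2) u(1) fin by (intro countable_UN) (auto intro: countable_finite)
  then have "\<not> (\<Union>u\<in>U. G u) \<subseteq> (\<Union>j\<in>J. G (u j))"
    using unc countable_subset by blast
  then obtain i v where i: "v \<in> U" "i \<in> G v" "\<And>j. j \<in> J \<Longrightarrow> i \<notin> G (u j)"
    by blast
  have "j \<in> G v" if "j \<in> J" for j
  proof (cases "u j \<le> v")
    case True
    then show ?thesis using decr i(2) i(3)[OF that] by blast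
  next
    case False
    then show ?thesis using decr[of v "u j"] u(2)[OF that] by (meson linear subsetD)
  qed
  then have "J \<subseteq> G v" by blast
  with fin[OF i(1)] J(3) show False
    using finite_subset by blast
qed

text \<open>This isolates the order-theoretic content. Weak*-convergence survives only as
  \<open>finite_avoids_zero\<close>, and boundedness in the dual as the common constant
  \<open>C\<close> for values and variations.\<close>

locale null_family =
  fixes F :: "'i \<Rightarrow> 'k::linorder \<Rightarrow> real" and C :: real and Q :: "'k set"
  assumes bounded: "\<bar>F i t\<bar> \<le> C"
    and variation: "sorted ts \<Longrightarrow> chain_variation (F i) ts \<le> C"
    and finite_avoids_zero: "s < t \<Longrightarrow> 0 < e \<Longrightarrow> finite {i. avoids_zero (F i) {s..<t} e}"
begin

lemma C_nonneg: "0 \<le> C"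
  using bounded[of undefined undefined] by linarith

lemma sum_le:
  assumes "finite S" "0 \<le> c" "0 \<le> d"
    and "\<And>s t. s \<in> S \<Longrightarrow> t \<in> S \<Longrightarrow> s < t \<Longrightarrow>
      \<exists>y\<in>{s..t}. \<bar>F i s\<bar> \<le> c * \<bar>F i s - F i y\<bar> + d"
  shows "(\<Sum>s\<in>S. \<bar>F i s\<bar>) \<le> C + real (card S) * d + c * C"
proof (cases "S = {}")
  case True
  then show ?thesis using assms(2,3) C_nonneg by simp
next
  case False
  have "\<exists>ts. sorted (Min S # ts) \<and>
    (\<Sum>s\<in>S. \<bar>F i s\<bar>) \<le> C + real (card S) * d + c * chain_variation (F i) (Min S # ts)"
    by (rule sum_le_chain_variation[OF assms(1) False assms(2) bounded assms(4) assms(3)])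
  then obtain ts where "sorted (Min S # ts)"
    "(\<Sum>s\<in>S. \<bar>F i s\<bar>) \<le> C + real (card S) * d + c * chain_variation (F i) (Min S # ts)"
    by blast
  then show ?thesis
    using mult_left_mono[OF variation \<open>0 \<le> c\<close>, of "Min S # ts" i] by linarith
qed

text \<open>Apart from finitely many \<open>i\<close>, the function avoids zero between no two
  points of \<open>S\<close>, so \<open>sum_le\<close> applies with factor 1. The tolerance
  \<open>d\<close> is chosen so that \<open>card S\<close> errors add up to at most 1, giving
  \<open>C + 1 + C\<close>.\<close>

lemma finite_sum_gt:
  assumes "finite S"
  shows "finite {i. (\<Sum>s\<in>S. \<bar>F i s\<bar>) > 2 * C + 1}"
proof -
  define d where "d = 1 / (real (card S) + 1)"
  have d: "0 < d" "real (card S) * d \<le> 1"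
    by (auto simp: d_def field_simps)
  have "finite (\<Union>(s, t)\<in>{p\<in>S \<times> S. fst p < snd p}. {i. avoids_zero (F i) {s..<t} d})"
    using assms d by (intro finite_UN_I) (auto intro!: finite_avoids_zero)
  moreover have "{i. (\<Sum>s\<in>S. \<bar>F i s\<bar>) > 2 * C + 1}
      \<subseteq> (\<Union>(s, t)\<in>{p\<in>S \<times> S. fst p < snd p}. {i. avoids_zero (F i) {s..<t} d})"
  proof (rule subsetI, rule ccontr)
    fix i
    assume i: "i \<in> {i. (\<Sum>s\<in>S. \<bar>F i s\<bar>) > 2 * C + 1}"
      "i \<notin> (\<Union>(s, t)\<in>{p\<in>S \<times> S. fst p < snd p}. {i. avoids_zero (F i) {s..<t} d})"
    have "\<exists>y\<in>{s..t}. \<bar>F i s\<bar> \<le> 1 * \<bar>F i s - F i y\<bar> + d"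
      if "s \<in> S" "t \<in> S" "s < t" for s t
    proof -
      have "\<not> avoids_zero (F i) {s..<t} d" using i(2) that by auto
      then show ?thesis by (rule not_avoids_zeroE[of _ _ _ s]) force
    qed
    then have "(\<Sum>s\<in>S. \<bar>F i s\<bar>) \<le> C + real (card S) * d + 1 * C"
      using assms d by (intro sum_le) auto
    with i(1) d(2) show False by simp
  qed
  ultimately show ?thesis by (rule finite_subset[rotated])
qed

text \<open>For infinite \<open>A\<close> the set \<open>G A\<close> is finite: enough points of
  \<open>A\<close> push the sum past \<open>2 * C + 1\<close>, contrary to
  \<open>finite_sum_gt\<close> for almost all \<open>i\<close>. Since \<open>{t..u}\<close> grows
  with \<open>u\<close>, these sets decrease, and \<open>countable_UN_decreasing\<close> handles the
  possibly uncountable union.\<close>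

lemma countable_infinite_interval:
  assumes "0 < e"
  shows "countable {i. \<exists>u\<in>Q. t < u \<and> infinite ({t..u} \<inter> Q) \<and> (\<forall>x\<in>{t..u} \<inter> Q. e \<le> \<bar>F i x\<bar>)}"
proof -
  define G where "G A = {i. \<forall>x\<in>A. e \<le> \<bar>F i x\<bar>}" for A
  have fin: "finite (G A)" if A: "infinite A" for A
  proof -
    define N where "N = Suc (nat \<lceil>(2 * C + 1) / e\<rceil>)"
    obtain S where S: "S \<subseteq> A" "finite S" "card S = N"
      using infinite_arbitrarily_large[OF A] by blast
    have "real N > (2 * C + 1) / e"
      unfolding N_def by linarith
    then have N: "real N * e > 2 * C + 1"
      using \<open>0 < e\<close> by (simp add: field_simps)
    have "G A \<subseteq> {i. (\<Sum>s\<in>S. \<bar>F i s\<bar>) > 2 * C + 1}"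
      unfolding G_def
    proof (rule Collect_mono, rule impI)
      fix i assume i: "\<forall>x\<in>A. e \<le> \<bar>F i x\<bar>"
      have "real (card S) * e \<le> (\<Sum>s\<in>S. \<bar>F i s\<bar>)"
        by (rule sum_bounded_below) (rule bspec[OF i subsetD[OF S(1)]])
      with S(3) N show "(\<Sum>s\<in>S. \<bar>F i s\<bar>) > 2 * C + 1" by simp
    qed
    then show ?thesis by (rule finite_subset[OF _ finite_sum_gt[OF S(2)]])
  qed
  have "countable (\<Union>u\<in>{u. infinite ({t..u} \<inter> Q)}. G ({t..u} \<inter> Q))"
  proof (rule countable_UN_decreasing)
    show "G ({t..v} \<inter> Q) \<subseteq> G ({t..u} \<inter> Q)" if "u \<le> v" for u v
      using that unfolding G_def by auto
  qed (simp add: fin)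
  then show ?thesis
    by (rule countable_subset[rotated]) (auto simp: G_def)
qed

text \<open>If \<open>i\<close> is not in \<open>irregular t\<close>, then up to each later
  \<open>u\<close> in \<open>Q\<close> one of two things happens. At finite
  \<open>Q\<close>-distance, \<open>F i\<close> is neither bounded below by a positive constant nor
  above by a negative one on \<open>{t..<u}\<close>; at infinite \<open>Q\<close>-distance, it takes
  arbitrarily small absolute values on \<open>{t..u} \<inter> Q\<close>. Either way the value at
  \<open>t\<close> can be paid for by variation before \<open>u\<close>.\<close>

definition irregular :: "'k \<Rightarrow> 'i set" where
  "irregular t =
     (\<Union>u\<in>{u\<in>Q. t < u \<and> finite ({t..u} \<inter> Q)}. \<Union>n. {i. avoids_zero (F i) {t..<u} (1 / Suc n)}) \<union>
     (\<Union>n. {i. \<exists>u\<in>Q. t < u \<and> infinite ({t..u} \<inter> Q) \<and> (\<forall>x\<in>{t..u} \<inter> Q. 1 / Suc n \<le> \<bar>F i x\<bar>)})"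

text \<open>Only countably many u lie at finite Q-distance from t, which settles the first union; the
  far points u need the preceding lemma.\<close>

lemma countable_irregular: "countable (irregular t)"
proof -
  have "countable {u\<in>Q. t < u \<and> finite ({t..u} \<inter> Q)}" (is "countable ?U")
  proof (rule countableI[where f = "\<lambda>u. card ({t..u} \<inter> Q)"], rule linorder_inj_onI)
    fix u v assume "u < v" "u \<in> ?U" "v \<in> ?U"
    then have "finite ({t..v} \<inter> Q)" "{t..u} \<inter> Q \<subseteq> {t..v} \<inter> Q"
      "v \<in> {t..v} \<inter> Q" "v \<notin> {t..u} \<inter> Q"
      by auto
    then have "card ({t..u} \<inter> Q) < card ({t..v} \<inter> Q)"
      by (metis psubsetI psubset_card_mono)
    then show "card ({t..u} \<inter> Q) \<noteq> card ({t..v} \<inter> Q)" by simp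
  qed auto
  then show ?thesis
    unfolding irregular_def
    by (intro countable_Un countable_UN[OF \<open>countable ?U\<close>] countable_UN[OF countableI_type]
        countable_infinite_interval countable_finite[OF finite_avoids_zero]) simp_all
qed

lemma irregular_finiteI:
  assumes "u \<in> Q" "t < u" "finite ({t..u} \<inter> Q)" "avoids_zero (F i) {t..<u} (1 / Suc n)"
  shows "i \<in> irregular t"
  unfolding irregular_def
  by (rule UnI1, rule UN_I[of u], use assms in simp, rule UN_I[of n], use assms in simp_all)

lemma irregular_infiniteI:
  assumes "u \<in> Q" "t < u" "infinite ({t..u} \<inter> Q)" "\<forall>x\<in>{t..u} \<inter> Q. 1 / Suc n \<le> \<bar>F i x\<bar>"
  shows "i \<in> irregular t"
  unfolding irregular_def
  by (rule UnI2, rule UN_I[of n], simp, rule CollectI, rule bexI[of _ u]) (intro conjI assms)+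

text \<open>At a regular point the error term can be made smaller than half of the value itself and
  absorbed into the factor 2. So \<open>sum_le\<close> applies with \<open>c = 2\<close> and
  \<open>d = 0\<close>, and the bound \<open>C + 2 * C\<close> does not depend on the size of
  \<open>S\<close>.\<close>

lemma sum_regular_le:
  assumes "finite S" "S \<subseteq> {t\<in>Q. i \<notin> irregular t}"
  shows "(\<Sum>s\<in>S. \<bar>F i s\<bar>) \<le> 3 * C"
proof -
  have "\<exists>y\<in>{s..t}. \<bar>F i s\<bar> \<le> 2 * \<bar>F i s - F i y\<bar> + 0"
    if st: "s \<in> S" "t \<in> S" "s < t" for s t
  proof (cases "F i s = 0")
    case True
    then show ?thesis using st by (intro bexI[of _ s]) auto
  next
    case False
    then obtain n where n: "inverse (real (Suc n)) < \<bar>F i s\<bar> / 2"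
      using reals_Archimedean[of "\<bar>F i s\<bar> / 2"] by auto
    have *: "i \<notin> irregular s" "t \<in> Q" "s \<in> Q" using st assms by auto
    show ?thesis
    proof (cases "finite ({s..t} \<inter> Q)")
      case True
      then have "\<not> avoids_zero (F i) {s..<t} (1 / Suc n)"
        using * st irregular_finiteI[of t s i n] True by blast
      then obtain y where "y \<in> {s..<t}" "\<bar>F i s\<bar> \<le> \<bar>F i s - F i y\<bar> + 1 / Suc n"
        by (rule not_avoids_zeroE[of _ _ _ s])
      with n show ?thesis
        by (intro bexI[of _ y]) (auto simp: inverse_eq_divide)
    next
      case False
      then have "\<not> (\<forall>x\<in>{s..t} \<inter> Q. 1 / Suc n \<le> \<bar>F i x\<bar>)"
        using * st irregular_infiniteI[of t s n i] False by blast
      then obtain y where "y \<in> {s..t}" "\<bar>F i y\<bar> < 1 / Suc n"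
        by (auto simp: not_le)
      moreover have "\<bar>F i s\<bar> \<le> \<bar>F i s - F i y\<bar> + \<bar>F i y\<bar>"
        by linarith
      moreover have "1 / real (Suc n) < \<bar>F i s\<bar> / 2"
        using n by (simp add: inverse_eq_divide)
      ultimately have "\<bar>F i s\<bar> \<le> 2 * \<bar>F i s - F i y\<bar> + 0"
        by argo
      with \<open>y \<in> {s..t}\<close> show ?thesis by blast
    qed
  qed
  then have "(\<Sum>s\<in>S. \<bar>F i s\<bar>) \<le> C + real (card S) * 0 + 2 * C"
    using assms by (intro sum_le) auto
  then show ?thesis by simp
qed

end

section \<open>Changing the set of a decomposition, and components of graphs with countable
  degrees\<close>

lemma type_c0l1_subset:
  assumes "type_c0l1 F P" "Q \<subseteq> P"
  shows "type_c0l1 F Q"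
proof -
  obtain a b D where ab: "\<forall>i. \<forall>t\<in>P. F i t = a i t + b i t"
    "\<forall>t\<in>P. lim_zero (\<lambda>i. a i t)"
    "\<forall>i S. finite S \<and> S \<subseteq> P \<longrightarrow> (\<Sum>t\<in>S. \<bar>b i t\<bar>) \<le> D"
    using assms(1) unfolding type_c0l1_def by (elim exE conjE)
  show ?thesis
    unfolding type_c0l1_def
    by (intro exI[of _ a] exI[of _ b] conjI exI[of _ D] allI ballI impI
        ab(1,2,3)[rule_format] subsetD[OF assms(2)] subset_trans[OF _ assms(2)])
      simp_all
qed

lemma type_c0l1_insert:
  assumes "type_c0l1 F Q" and bounded: "\<And>i. \<bar>F i p\<bar> \<le> B"
  shows "type_c0l1 F (insert p Q)"
proof -
  obtain a b D where ab: "\<forall>i. \<forall>t\<in>Q. F i t = a i t + b i t"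
    "\<forall>t\<in>Q. lim_zero (\<lambda>i. a i t)"
    "\<forall>i S. finite S \<and> S \<subseteq> Q \<longrightarrow> (\<Sum>t\<in>S. \<bar>b i t\<bar>) \<le> D"
    using assms(1) unfolding type_c0l1_def by (elim exE conjE)
  define a' where "a' i t = (if t = p then 0 else a i t)" for i t
  define b' where "b' i t = (if t = p then F i p else b i t)" for i t
  have 3: "(\<Sum>t\<in>S. \<bar>b' i t\<bar>) \<le> D + B" if "finite S" "S \<subseteq> insert p Q" for i S
  proof -
    have "(\<Sum>t\<in>S. \<bar>b' i t\<bar>) \<le> (\<Sum>t\<in>insert p S. \<bar>b' i t\<bar>)"
      using that by (intro sum_mono2) auto
    also have "\<dots> = \<bar>F i p\<bar> + (\<Sum>t\<in>S - {p}. \<bar>b' i t\<bar>)"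
      using that by (simp add: sum.insert_remove b'_def)
    also have "(\<Sum>t\<in>S - {p}. \<bar>b' i t\<bar>) = (\<Sum>t\<in>S - {p}. \<bar>b i t\<bar>)"
      by (intro sum.cong) (auto simp: b'_def)
    also have "\<dots> \<le> D"
      using that by (intro ab(3)[rule_format]) auto
    finally show ?thesis using bounded[of i] by simp
  qed
  have 2: "lim_zero (\<lambda>i. a' i t)" if "t \<in> insert p Q" for t
    using that ab(2) by (cases "t = p") (auto simp: a'_def lim_zero_def)
  have 1: "F i t = a' i t + b' i t" if "t \<in> insert p Q" for i t
    using that ab(1) by (auto simp: a'_def b'_def)
  show ?thesis
    unfolding type_c0l1_def
    by (intro exI[of _ a'] exI[of _ b'] conjI exI[of _ "D + B"] allI ballI impI 1 2 3) simp_all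
qed

text \<open>Two points are adjacent if some \<open>i\<close> is joined to both of them. Countability
  of all \<open>I s\<close> and \<open>T i\<close> makes every point have countably many neighbours,
  so the component \<open>K t\<close> is countable and can be enumerated.\<close>

lemma component_labelling:
  fixes T :: "'a \<Rightarrow> 'b set" and I :: "'b \<Rightarrow> 'a set"
  assumes T: "\<And>i. countable (T i)" and I: "\<And>t. countable (I t)"
  obtains q :: "'b \<Rightarrow> nat" and K :: "'b \<Rightarrow> 'b set"
  where "\<And>t. inj_on q (K t)" "\<And>i s t. s \<in> T i \<Longrightarrow> t \<in> T i \<Longrightarrow> i \<in> I s \<Longrightarrow> i \<in> I t \<Longrightarrow> s \<in> K t"
proof -
  define R where "R = {(s, t). \<exists>i. s \<in> T i \<and> t \<in> T i \<and> i \<in> I s \<and> i \<in> I t}"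
  define K where "K t = R\<^sup>* `` {t}" for t
  \<comment> \<open>Each point is labelled by the enumeration of its own component. Members of
    \<open>K t\<close> have the same component, so on \<open>K t\<close> the labels come from a
    single injection.\<close>
  define q where "q t = to_nat_on (K t) t" for t
  have "sym R" by (auto simp: R_def sym_def)
  then have sym: "sym (R\<^sup>*)" by (rule sym_rtrancl)
  have K_eq: "K s = K t" if "s \<in> K t" for s t
    using that sym unfolding K_def sym_def by (auto intro: rtrancl_trans)
  have "countable (R `` Y)" if "countable Y" for Y
  proof (rule countable_Image[OF _ that])
    fix s
    have "R `` {s} \<subseteq> (\<Union>i\<in>I s. T i)" by (auto simp: R_def)
    moreover have "countable (\<Union>i\<in>I s. T i)" using T I by (intro countable_UN) auto
    ultimately show "countable (R `` {s})" by (rule countable_subset)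
  qed
  then have "countable (K t)" for t
    unfolding K_def by (intro countable_rtrancl) auto
  then have "inj_on q (K t)" for t
  proof -
    have "inj_on (to_nat_on (K t)) (K t)"
      using \<open>countable (K t)\<close> by (rule inj_on_to_nat_on)
    then show ?thesis
      using K_eq by (auto simp: inj_on_def q_def)
  qed
  moreover have "s \<in> K t" if "s \<in> T i" "t \<in> T i" "i \<in> I s" "i \<in> I t" for i s t
    using that unfolding K_def R_def by blast
  ultimately show ?thesis by (rule that)
qed

section \<open>Oscillation points and the construction of the decomposition\<close>

context null_family
begin

text \<open>The intended \<open>l t\<close> and \<open>r t\<close> bound an order interval around
  \<open>t\<close> whose points in \<open>Q\<close> belong to \<open>V t\<close>. The threshold is
  half of \<open>e\<close> so that the drop from size \<open>e\<close> costs variation at least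
  \<open>e / 2\<close> on each side.\<close>

definition oscillating :: "('k \<Rightarrow> 'k) \<Rightarrow> ('k \<Rightarrow> 'k) \<Rightarrow> 'i \<Rightarrow> real \<Rightarrow> 'k set" where
  "oscillating l r i e = {t\<in>Q. e \<le> \<bar>F i t\<bar> \<and>
     \<not> avoids_zero (F i) {l t..<t} (e / 2) \<and> \<not> avoids_zero (F i) {t..<r t} (e / 2)}"

lemma finite_not_oscillating:
  assumes "l t < t" "t < r t" "0 < e" "t \<in> Q"
  shows "finite {i. e \<le> \<bar>F i t\<bar> \<and> t \<notin> oscillating l r i e}"
proof (rule finite_subset)
  show "{i. e \<le> \<bar>F i t\<bar> \<and> t \<notin> oscillating l r i e}
      \<subseteq> {i. avoids_zero (F i) {l t..<t} (e / 2)} \<union> {i. avoids_zero (F i) {t..<r t} (e / 2)}"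
    using assms by (auto simp: oscillating_def)
qed (use assms in \<open>simp add: finite_avoids_zero\<close>)

text \<open>Around a point of this set the function varies by at least e/2 on either side inside
  its neighbourhood. Hence two such points whose v-values differ by less than e/2 lie in the
  neighbourhoods of each other.\<close>

lemma countable_oscillating:
  assumes sep: "\<And>M. M \<subseteq> Q \<Longrightarrow> \<forall>x\<in>M. \<forall>y\<in>M. x \<in> V y \<Longrightarrow> countable M"
    and lr: "\<And>t. t \<in> Q \<Longrightarrow> l t < t \<and> t < r t"
    and V: "\<And>s t. s \<in> Q \<Longrightarrow> t \<in> Q \<Longrightarrow> l t < s \<Longrightarrow> s < r t \<Longrightarrow> s \<in> V t"
    and v: "\<And>s t. s \<le> t \<Longrightarrow> \<bar>F i t - F i s\<bar> \<le> v t - v s"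
    and "0 < e"
  shows "countable (oscillating l r i e)"
proof -
  \<comment> \<open>Equal floors force the \<open>v\<close>-values to differ by less than
    \<open>e / 2\<close>. There are countably many integers \<open>k\<close>, so it suffices that
    each \<open>M k\<close> is countable.\<close>
  define M where "M k = {t\<in>oscillating l r i e. \<lfloor>v t / (e / 2)\<rfloor> = k}" for k
  have mono: "v s \<le> v t" if "s \<le> t" for s t
    using v[OF that] by linarith
  have left: "v (l t) + e / 2 \<le> v t" if "t \<in> oscillating l r i e" for t
  proof -
    have *: "\<not> avoids_zero (F i) {l t..<t} (e / 2)" "e \<le> \<bar>F i t\<bar>"
      using that by (auto simp: oscillating_def)
    from *(1) obtain x where "x \<in> {l t..<t}" "\<bar>F i t\<bar> \<le> \<bar>F i t - F i x\<bar> + e / 2"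
      by (rule not_avoids_zeroE[of _ _ _ t])
    moreover from this have "\<bar>F i t - F i x\<bar> \<le> v t - v x" "v (l t) \<le> v x"
      by (auto intro: v mono)
    ultimately show ?thesis using *(2) by linarith
  qed
  have right: "v t + e / 2 \<le> v (r t)" if "t \<in> oscillating l r i e" for t
  proof -
    have *: "\<not> avoids_zero (F i) {t..<r t} (e / 2)" "e \<le> \<bar>F i t\<bar>"
      using that by (auto simp: oscillating_def)
    from *(1) obtain x where "x \<in> {t..<r t}" "\<bar>F i t\<bar> \<le> \<bar>F i t - F i x\<bar> + e / 2"
      by (rule not_avoids_zeroE[of _ _ _ t])
    moreover from this have "\<bar>F i x - F i t\<bar> \<le> v x - v t" "v x \<le> v (r t)"
      by (auto intro: v mono)
    ultimately show ?thesis using *(2) by linarith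
  qed
  have "countable (M k)" for k
  proof (rule sep)
    show "M k \<subseteq> Q" by (auto simp: M_def oscillating_def)
    show "\<forall>x\<in>M k. \<forall>y\<in>M k. x \<in> V y"
    proof (intro ballI)
      fix x y assume xy: "x \<in> M k" "y \<in> M k"
      then have mem: "x \<in> oscillating l r i e" "y \<in> oscillating l r i e"
        and fl: "\<lfloor>v x / (e / 2)\<rfloor> = \<lfloor>v y / (e / 2)\<rfloor>"
        by (auto simp: M_def)
      from fl have "\<bar>v x / (e / 2) - v y / (e / 2)\<bar> < 1" by linarith
      then have "\<bar>v x - v y\<bar> / \<bar>e / 2\<bar> < 1"
        by (simp only: diff_divide_distrib flip: abs_divide)
      then have close: "\<bar>v x - v y\<bar> < e / 2"
        using \<open>0 < e\<close> by (simp only: abs_of_pos pos_divide_less_eq half_gt_zero mult_1)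
      show "x \<in> V y"
      proof (rule V)
        show "x \<in> Q" "y \<in> Q" using mem by (auto simp: oscillating_def)
        show "l y < x"
        proof (rule ccontr)
          assume "\<not> l y < x"
          then have "v x \<le> v (l y)" by (intro mono) simp
          with left[OF mem(2)] close show False by linarith
        qed
        show "x < r y"
        proof (rule ccontr)
          assume "\<not> x < r y"
          then have "v (r y) \<le> v x" by (intro mono) simp
          with right[OF mem(2)] close show False by linarith
        qed
      qed
    qed
  qed
  moreover have "oscillating l r i e = (\<Union>k. M k)"
    by (auto simp: M_def)
  ultimately show ?thesis by simp
qed

text \<open>Pairs (i,t) with t outside T i go to a. Pairs with t in T i and i regular at t go to b,
  by sum_regular_le. The remaining pairs form a graph with countable degrees; there b takes an
  initial segment of an enumeration of the component, cut off before the sum exceeds 2C+1, and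
  finite_sum_gt shows that each t is cut off for finitely many i only.\<close>

lemma type_c0l1_if_locally_countable:
  assumes T: "\<And>i. countable (T i)" and subQ: "\<And>i. T i \<subseteq> Q"
    and fin: "\<And>t e. t \<in> Q \<Longrightarrow> 0 < e \<Longrightarrow> finite {i. t \<notin> T i \<and> e \<le> \<bar>F i t\<bar>}"
  shows "type_c0l1 F Q"
proof -
  obtain q :: "'k \<Rightarrow> nat" and K where q: "\<And>t. inj_on q (K t)"
    and K: "\<And>i s t. s \<in> T i \<Longrightarrow> t \<in> T i \<Longrightarrow> i \<in> irregular s \<Longrightarrow> i \<in> irregular t \<Longrightarrow> s \<in> K t"
    by (rule component_labelling[of T irregular, OF T countable_irregular]) metis
  \<comment> \<open>The sum tested at \<open>t\<close> runs over all irregular points of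
    \<open>T i\<close> up to and including \<open>t\<close>, whether kept or not. Once it exceeds
    the threshold, every later point is therefore cut off too.\<close>
  define P where "P i t = {s\<in>K t. s \<in> T i \<and> i \<in> irregular s \<and> q s \<le> q t}" for i t
  define keep where "keep i t \<longleftrightarrow> t \<in> T i \<and>
    (i \<in> irregular t \<longrightarrow> (\<Sum>s\<in>P i t. \<bar>F i s\<bar>) \<le> 2 * C + 1)" for i t
  define a where "a i t = (if keep i t then 0 else F i t)" for i t
  define b where "b i t = (if keep i t then F i t else 0)" for i t
  have finK: "finite {s\<in>K t. q s \<le> q t}" for t
  proof (rule finite_imageD)
    show "finite (q ` {s\<in>K t. q s \<le> q t})"
      by (rule finite_subset[of _ "{..q t}"]) auto
    show "inj_on q {s\<in>K t. q s \<le> q t}"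
      using q[of t] by (rule inj_on_subset) auto
  qed
  have "lim_zero (\<lambda>i. a i t)" if "t \<in> Q" for t
    unfolding lim_zero_def
  proof (intro allI impI)
    fix e :: real assume "0 < e"
    have "{i. e \<le> \<bar>a i t\<bar>} \<subseteq> {i. t \<notin> T i \<and> e \<le> \<bar>F i t\<bar>} \<union>
        {i. (\<Sum>s\<in>{s\<in>K t. q s \<le> q t}. \<bar>F i s\<bar>) > 2 * C + 1}"
    proof
      fix i assume "i \<in> {i. e \<le> \<bar>a i t\<bar>}"
      then have i: "\<not> keep i t" "e \<le> \<bar>F i t\<bar>"
        using \<open>0 < e\<close> by (auto simp: a_def split: if_splits)
      \<comment> \<open>\<open>P i t\<close> varies with \<open>i\<close>; it is enlarged to a
        finite set independent of \<open>i\<close>, to which \<open>finite_sum_gt\<close>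
        applies.\<close>
      have "(\<Sum>s\<in>P i t. \<bar>F i s\<bar>) \<le> (\<Sum>s\<in>{s\<in>K t. q s \<le> q t}. \<bar>F i s\<bar>)"
        by (rule sum_mono2[OF finK]) (auto simp: P_def)
      with i show "i \<in> {i. t \<notin> T i \<and> e \<le> \<bar>F i t\<bar>} \<union>
          {i. (\<Sum>s\<in>{s\<in>K t. q s \<le> q t}. \<bar>F i s\<bar>) > 2 * C + 1}"
        unfolding keep_def by auto
    qed
    moreover have "finite ({i. t \<notin> T i \<and> e \<le> \<bar>F i t\<bar>} \<union>
        {i. (\<Sum>s\<in>{s\<in>K t. q s \<le> q t}. \<bar>F i s\<bar>) > 2 * C + 1})"
      using fin[OF that \<open>0 < e\<close>] finite_sum_gt[OF finK] by simp
    ultimately show "finite {i. e \<le> \<bar>a i t\<bar>}" by (rule finite_subset)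
  qed
  moreover have "(\<Sum>t\<in>S. \<bar>b i t\<bar>) \<le> 5 * C + 1" if S: "finite S" "S \<subseteq> Q" for i S
  proof -
    define A where "A = {t\<in>S. keep i t \<and> i \<notin> irregular t}"
    define B where "B = {t\<in>S. keep i t \<and> i \<in> irregular t}"
    have AB: "finite A" "finite B" "A \<inter> B = {}" "A \<union> B \<subseteq> S"
      using S by (auto simp: A_def B_def)
    have "(\<Sum>t\<in>S. \<bar>b i t\<bar>) = (\<Sum>t\<in>A \<union> B. \<bar>b i t\<bar>)"
      by (rule sum.mono_neutral_right) (use S AB in \<open>auto simp: A_def B_def b_def\<close>)
    also have "\<dots> = (\<Sum>t\<in>A \<union> B. \<bar>F i t\<bar>)"
      by (rule sum.cong) (auto simp: A_def B_def b_def)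
    also have "\<dots> = (\<Sum>t\<in>A. \<bar>F i t\<bar>) + (\<Sum>t\<in>B. \<bar>F i t\<bar>)"
      using AB by (intro sum.union_disjoint)
    also have "(\<Sum>t\<in>A. \<bar>F i t\<bar>) \<le> 3 * C"
      using S AB(1) by (intro sum_regular_le) (auto simp: A_def)
    also have "(\<Sum>t\<in>B. \<bar>F i t\<bar>) \<le> 2 * C + 1"
    proof (cases "B = {}")
      case True
      then show ?thesis using C_nonneg by simp
    next
      case False
      \<comment> \<open>Let \<open>t\<close> be the point of \<open>B\<close> with the largest
        label. All points of \<open>B\<close> share the index \<open>i\<close>, hence lie in the
        component of \<open>t\<close>, so \<open>B\<close> is contained in \<open>P i t\<close>. The
        sum over \<open>P i t\<close> is small because \<open>t\<close> was kept.\<close>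
      have "Max (q ` B) \<in> q ` B" using AB(2) False by (intro Max_in) auto
      then obtain t where t: "t \<in> B" "q t = Max (q ` B)" by auto
      have memB: "s \<in> T i" "i \<in> irregular s" if "s \<in> B" for s
        using that by (auto simp: B_def keep_def)
      have "B \<subseteq> P i t"
      proof
        fix s assume s: "s \<in> B"
        then have "s \<in> K t" using memB t(1) by (intro K[of s i t]) auto
        moreover have "q s \<le> q t" using s AB(2) t(2) by simp
        ultimately show "s \<in> P i t" using memB[OF s] by (simp add: P_def)
      qed
      moreover have "finite (P i t)"
        by (rule finite_subset[OF _ finK[of t]]) (auto simp: P_def)
      ultimately have "(\<Sum>t\<in>B. \<bar>F i t\<bar>) \<le> (\<Sum>s\<in>P i t. \<bar>F i s\<bar>)"
        by (intro sum_mono2) auto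
      also have "\<dots> \<le> 2 * C + 1" using t(1) by (simp add: B_def keep_def)
      finally show ?thesis .
    qed
    finally show ?thesis by simp
  qed
  moreover have "F i t = a i t + b i t" for i t
    by (simp add: a_def b_def)
  ultimately show ?thesis
    unfolding type_c0l1_def by (intro exI[of _ a] exI[of _ b] conjI exI[of _ "5 * C + 1"]) simp_all
qed

text \<open>The thresholds \<open>1 / Suc n\<close> reach below every positive \<open>e\<close>.
  Thus the union \<open>T i\<close> is countable by \<open>countable_oscillating\<close> and misses
  a given \<open>t\<close> with a value of size at least \<open>e\<close> for finitely many
  \<open>i\<close> only, by \<open>finite_not_oscillating\<close>.\<close>

lemma type_c0l1_if_separating:
  assumes sep: "\<And>M. M \<subseteq> Q \<Longrightarrow> \<forall>x\<in>M. \<forall>y\<in>M. x \<in> V y \<Longrightarrow> countable M"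
    and lr: "\<And>t. t \<in> Q \<Longrightarrow> l t < t \<and> t < r t"
    and V: "\<And>s t. s \<in> Q \<Longrightarrow> t \<in> Q \<Longrightarrow> l t < s \<Longrightarrow> s < r t \<Longrightarrow> s \<in> V t"
    and v: "\<And>i s t. s \<le> t \<Longrightarrow> \<bar>F i t - F i s\<bar> \<le> v i t - v i s"
  shows "type_c0l1 F Q"
proof -
  define T where "T i = (\<Union>n. oscillating l r i (1 / Suc n))" for i
  show ?thesis
  proof (rule type_c0l1_if_locally_countable)
    show "countable (T i)" for i
      unfolding T_def
      by (intro countable_UN countable_oscillating[OF sep lr V v]) auto
    show "T i \<subseteq> Q" for i
      by (auto simp: T_def oscillating_def)
    fix t and e :: real assume t: "t \<in> Q" and "0 < e"
    then obtain n where n: "1 / Suc n < e"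
      using reals_Archimedean[of e] by (auto simp: inverse_eq_divide)
    show "finite {i. t \<notin> T i \<and> e \<le> \<bar>F i t\<bar>}"
    proof (rule finite_subset)
      show "{i. t \<notin> T i \<and> e \<le> \<bar>F i t\<bar>}
          \<subseteq> {i. 1 / Suc n \<le> \<bar>F i t\<bar> \<and> t \<notin> oscillating l r i (1 / Suc n)}"
        using n by (auto simp: T_def)
      show "finite {i. 1 / Suc n \<le> \<bar>F i t\<bar> \<and> t \<notin> oscillating l r i (1 / Suc n)}"
        using lr[OF t] t by (intro finite_not_oscillating) auto
    qed
  qed
qed

end

section \<open>Continuous functions against a signed measure on a compact line\<close>

locale signed_measure =
  fixes mp mn :: "'k::topological_space measure"
  assumes fin_p: "finite_measure mp" and fin_n: "finite_measure mn"
    and sets_p [measurable_cong]: "sets mp = sets borel"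
    and sets_n [measurable_cong]: "sets mn = sets borel"
begin

abbreviation J :: "('k \<Rightarrow> real) \<Rightarrow> real" where
  "J \<equiv> signed_integral mp mn"

definition total_mass :: real where
  "total_mass = measure mp UNIV + measure mn UNIV"

lemma integrable_bounded:
  fixes f :: "'k \<Rightarrow> real"
  assumes "f \<in> borel_measurable borel" "\<And>x. \<bar>f x\<bar> \<le> c"
  shows "integrable mp f" "integrable mn f"
  using assms
  by (auto intro!: finite_measure.integrable_const_bound[OF fin_p, of f c]
      finite_measure.integrable_const_bound[OF fin_n, of f c]
      simp: measurable_cong_sets[OF sets_p refl] measurable_cong_sets[OF sets_n refl])

lemma space_eq: "space mp = UNIV" "space mn = UNIV"
  using sets_eq_imp_space_eq[OF sets_p] sets_eq_imp_space_eq[OF sets_n] by auto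

lemma abs_J_le:
  assumes "f \<in> borel_measurable borel" "\<And>x. \<bar>f x\<bar> \<le> c"
  shows "\<bar>J f\<bar> \<le> c * total_mass"
proof -
  have int: "integrable mp f" "integrable mn f"
    using integrable_bounded[OF assms] by auto
  have "\<bar>integral\<^sup>L mp f\<bar> \<le> (\<integral>x. c \<partial>mp)"
    using int assms(2) finite_measure.integrable_const[OF fin_p]
    by (intro integral_abs_bound[THEN order_trans] integral_mono) auto
  moreover have "\<bar>integral\<^sup>L mn f\<bar> \<le> (\<integral>x. c \<partial>mn)"
    using int assms(2) finite_measure.integrable_const[OF fin_n]
    by (intro integral_abs_bound[THEN order_trans] integral_mono) auto
  ultimately show ?thesis
    by (simp add: signed_integral_def total_mass_def space_eq algebra_simps)
qed

lemma J_add: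
  assumes "f \<in> borel_measurable borel" "\<And>x. \<bar>f x\<bar> \<le> c"
    and "g \<in> borel_measurable borel" "\<And>x. \<bar>g x\<bar> \<le> d"
  shows "J (\<lambda>x. f x + g x) = J f + J g"
  using integrable_bounded[OF assms(1,2)] integrable_bounded[OF assms(3,4)]
  by (simp add: signed_integral_def)

lemma J_diff:
  assumes "f \<in> borel_measurable borel" "\<And>x. \<bar>f x\<bar> \<le> c"
    and "g \<in> borel_measurable borel" "\<And>x. \<bar>g x\<bar> \<le> d"
  shows "J (\<lambda>x. f x - g x) = J f - J g"
  using integrable_bounded[OF assms(1,2)] integrable_bounded[OF assms(3,4)]
  by (simp add: signed_integral_def)

lemma J_scale: "J (\<lambda>x. c * f x) = c * J f"
  by (simp add: signed_integral_def algebra_simps)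

end

text \<open>The integrals are bounded linear functionals on the Banach space of bounded continuous
  functions. Convergence to zero bounds them pointwise, and the uniform boundedness principle
  applies.\<close>

lemma weak_star_null_bounded:
  fixes F :: "'i \<Rightarrow> 'k::topological_space \<Rightarrow> real"
  assumes meas: "\<And>i. signed_measure (mp i) (mn i)"
    and null: "weak_star_null F mp mn"
  shows "\<exists>B. \<forall>i f. continuous_on UNIV f \<longrightarrow> (\<forall>x. \<bar>f x\<bar> \<le> 1) \<longrightarrow>
    \<bar>signed_integral (mp i) (mn i) f\<bar> \<le> B"
proof -
  define T where "T i \<phi> = signed_integral (mp i) (mn i) (apply_bcontfun \<phi>)"
    for i and \<phi> :: "'k \<Rightarrow>\<^sub>C real"
  have meas_b: "apply_bcontfun \<phi> \<in> borel_measurable borel" for \<phi> :: "'k \<Rightarrow>\<^sub>C real"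
    by (intro borel_measurable_continuous_onI continuous_on_apply_bcontfun)
  have le_norm: "\<bar>apply_bcontfun \<phi> x\<bar> \<le> norm \<phi>" for \<phi> :: "'k \<Rightarrow>\<^sub>C real" and x
    using norm_bounded[of \<phi> x] by simp
  have "bounded_linear (T i)" for i
  proof -
    interpret signed_measure "mp i" "mn i" by (rule meas)
    show ?thesis
    proof (rule bounded_linear_intro)
      show "T i (\<phi> + \<psi>) = T i \<phi> + T i \<psi>" for \<phi> \<psi>
        unfolding T_def plus_bcontfun.rep_eq by (rule J_add) (rule meas_b le_norm)+
      show "T i (r *\<^sub>R \<phi>) = r *\<^sub>R T i \<phi>" for r \<phi>
        by (simp add: T_def J_scale)
      show "norm (T i \<phi>) \<le> norm \<phi> * total_mass" for \<phi>
        unfolding T_def real_norm_def by (rule abs_J_le) (rule meas_b le_norm)+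
    qed
  qed
  moreover have "\<exists>B. \<forall>i. norm (T i \<phi>) \<le> B" for \<phi>
  proof -
    have "lim_zero (\<lambda>i. T i \<phi>)"
      using null continuous_on_apply_bcontfun unfolding T_def weak_star_null_def by blast
    then have fin: "finite {i. 1 \<le> \<bar>T i \<phi>\<bar>}"
      by (simp add: lim_zero_def)
    \<comment> \<open>The inserted 1 keeps the set nonempty and covers the indices whose value is
      below 1.\<close>
    define B where "B = Max (insert 1 ((\<lambda>i. \<bar>T i \<phi>\<bar>) ` {i. 1 \<le> \<bar>T i \<phi>\<bar>}))"
    have "1 \<le> B" unfolding B_def using fin by (intro Max_ge) auto
    moreover have "\<bar>T i \<phi>\<bar> \<le> B" if "1 \<le> \<bar>T i \<phi>\<bar>" for i
      unfolding B_def using fin that by (intro Max_ge) auto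
    ultimately have "norm (T i \<phi>) \<le> B" for i by (cases "1 \<le> \<bar>T i \<phi>\<bar>") auto
    then show ?thesis by blast
  qed
  ultimately obtain B where B: "\<And>i \<phi>. norm (T i \<phi>) \<le> B * norm \<phi>"
    using uniform_boundedness[OF complete_UNIV_bcontfun, of T] by blast
  have "\<bar>signed_integral (mp i) (mn i) f\<bar> \<le> \<bar>B\<bar>"
    if f: "continuous_on UNIV f" "\<forall>x. \<bar>f x\<bar> \<le> 1" for i f
  proof -
    have bc: "f \<in> bcontfun" using f by (intro bcontfun_normI[of _ 1]) auto
    have "norm (Bcontfun f) \<le> 1"
      using f(2) by (intro norm_bound) (simp add: Bcontfun_inverse[OF bc])
    then have "B * norm (Bcontfun f) \<le> \<bar>B\<bar> * 1"
      by (intro mult_mono) auto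
    then show ?thesis
      using B[of i "Bcontfun f"] by (simp add: T_def Bcontfun_inverse[OF bc])
  qed
  then show ?thesis by blast
qed

section \<open>Signed measures on a compact line tested against continuous steps\<close>

locale compact_line_measure = signed_measure mp mn
  for mp mn :: "'k::linorder_topology measure" +
  fixes F :: "'k \<Rightarrow> real"
  assumes compact: "compact (UNIV :: 'k set)"
    and F_eq: "F t = measure mp {..t} - measure mn {..t}"
begin

text \<open>Layer-cake: the superlevel sets of f are initial segments {..r} with r between
  s and t, so the integral of f is a limit of averages of values F(r).\<close>

lemma J_approx:
  assumes f: "continuous_on UNIV f" "antimono f" "\<And>x. f x \<in> {0..1}"
    "\<And>x. x \<le> s \<Longrightarrow> f x = 1" "\<And>x. t \<le> x \<Longrightarrow> f x = 0"
    and n: "0 < n"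
  shows "\<exists>r. (\<forall>k. r k \<in> {s..<t}) \<and>
    \<bar>J f - (\<Sum>k<n. F (r k)) / real n\<bar> \<le> total_mass / real n"
proof -
  \<comment> \<open>The levels are \<open>Suc k / n\<close> for \<open>k < n\<close>: positive, so
    that \<open>A k\<close> misses every point from \<open>t\<close> on, and at most 1, so that
    \<open>s\<close> belongs to it. Compactness gives \<open>A k\<close> a maximum \<open>r\<close>.
    For \<open>k \<ge> n\<close> the value \<open>s\<close> is a mere default.\<close>
  define A where "A k = {x. real (Suc k) / real n \<le> f x}" for k
  have "\<exists>r\<in>{s..<t}. k < n \<longrightarrow> A k = {..r}" for k
  proof (cases "k < n")
    case False
    have "s < t" using f(4)[of s] f(5)[of s] by (cases "t \<le> s") auto
    then show ?thesis using False by (intro bexI[of _ s]) auto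
  next
    case True
    have s: "s \<in> A k" using True f(4)[of s] by (simp add: A_def)
    have "closed (A k)" unfolding A_def
      using f(1) by (intro closed_Collect_le continuous_intros)
    then have "compact (A k)"
      using compact compact_Int_closed[of UNIV "A k"] by simp
    then obtain r where r: "r \<in> A k" "\<And>x. x \<in> A k \<Longrightarrow> x \<le> r"
      using s compact_attains_sup[of "A k"] by auto
    have "A k = {..r}"
    proof (intro equalityI subsetI)
      fix x assume "x \<in> {..r}"
      then have "f r \<le> f x" using f(2) by (auto dest: antimonoD)
      then show "x \<in> A k" using r(1) by (simp add: A_def)
    qed (use r(2) in auto)
    moreover have "r < t"
    proof (rule ccontr)
      assume "\<not> r < t"
      then have "f r = 0" using f(5) by simp
      moreover have "0 < real (Suc k) / real n" using n by simp
      ultimately show False using r(1) by (simp add: A_def)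
    qed
    ultimately show ?thesis using r(2)[OF s] by (intro bexI[of _ r]) auto
  qed
  then obtain r where r: "\<And>k. r k \<in> {s..<t}" "\<And>k. k < n \<Longrightarrow> A k = {..r k}"
    by metis
  define g where "g x = (\<Sum>k<n. indicat_real {..r k} x) / real n" for x
  have g_meas: "g \<in> borel_measurable borel"
    unfolding g_def by measurable
  have f_meas: "f \<in> borel_measurable borel"
    using f(1) by (rule borel_measurable_continuous_onI)
  have g_bound: "\<bar>g x\<bar> \<le> 1" for x
  proof -
    have "(\<Sum>k<n. indicat_real {..r k} x) \<le> (\<Sum>k<n. 1)"
      by (intro sum_mono) (simp add: indicator_def)
    moreover have "0 \<le> (\<Sum>k<n. indicat_real {..r k} x)"
      by (intro sum_nonneg) simp
    ultimately show ?thesis using n by (simp add: g_def)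
  qed
  have f_bound: "\<bar>f x\<bar> \<le> 1" for x using f(3)[of x] by auto
  have close: "\<bar>f x - g x\<bar> \<le> 1 / real n" for x
  proof -
    \<comment> \<open>\<open>m\<close> counts the levels not exceeding \<open>f x\<close>, so
      \<open>g\<close> is \<open>f\<close> rounded down to a multiple of
      \<open>1 / n\<close>.\<close>
    define m where "m = nat \<lfloor>real n * f x\<rfloor>"
    have nf: "0 \<le> real n * f x" "real n * f x \<le> real n"
      using f(3)[of x] by (auto simp: mult_left_le)
    then have m: "real m \<le> real n * f x" "real n * f x < real m + 1"
      unfolding m_def by linarith+
    have iff: "x \<le> r k \<longleftrightarrow> k < m" if "k < n" for k
    proof -
      have "x \<le> r k \<longleftrightarrow> x \<in> A k" using r(2)[OF that] by simp
      also have "\<dots> \<longleftrightarrow> real (Suc k) \<le> real n * f x"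
        using n by (simp add: A_def field_simps)
      also have "\<dots> \<longleftrightarrow> k < m"
        unfolding m_def using nf(1) by linarith
      finally show ?thesis .
    qed
    have "m \<le> n" using m(1) nf(2) by simp
    have "(\<Sum>k<n. indicat_real {..r k} x) = (\<Sum>k<n. if k < m then 1 else 0)"
      by (intro sum.cong) (auto simp: iff indicator_def)
    also have "\<dots> = real (card ({..<n} \<inter> {k. k < m}))"
      by (simp add: sum.If_cases)
    also have "{..<n} \<inter> {k. k < m} = {..<m}" using \<open>m \<le> n\<close> by auto
    finally have "g x = real m / real n" by (simp add: g_def)
    then have "f x - g x = (real n * f x - real m) / real n"
      using n by (simp add: field_simps)
    moreover have "\<bar>real n * f x - real m\<bar> \<le> 1" using m by linarith
    ultimately show ?thesis using n by (simp add: divide_right_mono)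
  qed
  have "J g = (\<Sum>k<n. F (r k)) / real n"
  proof -
    have "integral\<^sup>L mp g = (\<Sum>k<n. measure mp {..r k}) / real n"
      unfolding g_def using finite_measure.emeasure_finite[OF fin_p]
      by (simp add: sets_p space_eq top.not_eq_extremum)
    moreover have "integral\<^sup>L mn g = (\<Sum>k<n. measure mn {..r k}) / real n"
      unfolding g_def using finite_measure.emeasure_finite[OF fin_n]
      by (simp add: sets_n space_eq top.not_eq_extremum)
    ultimately show ?thesis
      by (simp add: signed_integral_def F_eq sum_subtractf diff_divide_distrib)
  qed
  moreover have "\<bar>J f - J g\<bar> \<le> total_mass / real n"
  proof -
    have "J f - J g = J (\<lambda>x. f x - g x)"
      using J_diff[OF f_meas f_bound g_meas g_bound] by simp
    also have "\<bar>\<dots>\<bar> \<le> 1 / real n * total_mass"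
      using f_meas g_meas close by (intro abs_J_le) auto
    finally show ?thesis by simp
  qed
  ultimately show ?thesis using r(1) by auto
qed

text \<open>The averages of values of \<open>F\<close> in \<open>J_approx\<close> inherit any bound
  for \<open>F\<close> on \<open>{s..<t}\<close>, and the error \<open>total_mass / n\<close>
  vanishes in the limit.\<close>

lemma J_bounds:
  assumes f: "continuous_on UNIV f" "antimono f" "\<And>x. f x \<in> {0..1}"
    "\<And>x. x \<le> s \<Longrightarrow> f x = 1" "\<And>x. t \<le> x \<Longrightarrow> f x = 0"
  shows J_ge: "(\<And>r. r \<in> {s..<t} \<Longrightarrow> A \<le> F r) \<Longrightarrow> A \<le> J f"
    and J_le: "(\<And>r. r \<in> {s..<t} \<Longrightarrow> F r \<le> B) \<Longrightarrow> J f \<le> B"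
proof -
  have lim: "(\<lambda>n. total_mass / real (Suc n)) \<longlonglongrightarrow> 0"
    by (rule LIMSEQ_Suc) (rule lim_const_over_n)
  show "A \<le> J f" if A: "\<And>r. r \<in> {s..<t} \<Longrightarrow> A \<le> F r"
  proof (rule LIMSEQ_le_const2)
    show "(\<lambda>n. A - total_mass / real (Suc n)) \<longlonglongrightarrow> A"
      using tendsto_diff[OF tendsto_const lim, of A] by simp
    have "A - total_mass / real (Suc n) \<le> J f" for n
    proof -
      obtain r where r: "\<And>k. r k \<in> {s..<t}"
        "\<bar>J f - (\<Sum>k<Suc n. F (r k)) / real (Suc n)\<bar> \<le> total_mass / real (Suc n)"
        using J_approx[OF f zero_less_Suc] by blast
      have "real (card {..<Suc n}) * A \<le> (\<Sum>k<Suc n. F (r k))"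
        by (rule sum_bounded_below) (rule A[OF r(1)])
      then have "A \<le> (\<Sum>k<Suc n. F (r k)) / real (Suc n)"
        by (simp only: card_lessThan pos_le_divide_eq of_nat_0_less_iff zero_less_Suc mult.commute)
      with r(2) show ?thesis by linarith
    qed
    then show "\<exists>N. \<forall>n\<ge>N. A - total_mass / real (Suc n) \<le> J f" by blast
  qed
  show "J f \<le> B" if B: "\<And>r. r \<in> {s..<t} \<Longrightarrow> F r \<le> B"
  proof (rule LIMSEQ_le_const)
    show "(\<lambda>n. B + total_mass / real (Suc n)) \<longlonglongrightarrow> B"
      using tendsto_add[OF tendsto_const lim, of B] by simp
    have "J f \<le> B + total_mass / real (Suc n)" for n
    proof -
      obtain r where r: "\<And>k. r k \<in> {s..<t}"
        "\<bar>J f - (\<Sum>k<Suc n. F (r k)) / real (Suc n)\<bar> \<le> total_mass / real (Suc n)"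
        using J_approx[OF f zero_less_Suc] by blast
      have "(\<Sum>k<Suc n. F (r k)) \<le> real (card {..<Suc n}) * B"
        by (rule sum_bounded_above) (rule B[OF r(1)])
      then have "(\<Sum>k<Suc n. F (r k)) / real (Suc n) \<le> B"
        by (simp only: card_lessThan pos_divide_le_eq of_nat_0_less_iff zero_less_Suc mult.commute)
      with r(2) show ?thesis by linarith
    qed
    then show "\<exists>N. \<forall>n\<ge>N. J f \<le> B + total_mass / real (Suc n)" by blast
  qed
qed

text \<open>Right-continuity keeps \<open>F\<close> within \<open>d\<close> of \<open>F x\<close> on
  some \<open>{x..<b}\<close>. A monotone step that has come down by \<open>min b t\<close> then has
  its integral in the same range, by \<open>J_bounds\<close>.\<close>

lemma narrow_step_exists:
  assumes right_cont: "(F \<longlongrightarrow> F x) (at_right x)" and "x < t" "0 < d"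
  obtains f where "continuous_on UNIV f" "\<And>z. f z \<in> {0..1}" "\<And>z. z \<le> x \<Longrightarrow> f z = 1"
    "\<And>z. t \<le> z \<Longrightarrow> f z = 0" "\<bar>J f - F x\<bar> \<le> d"
proof -
  have "\<forall>\<^sub>F y in at_right x. dist (F y) (F x) < d"
    using right_cont \<open>0 < d\<close> by (rule tendstoD)
  then obtain b where b: "x < b" "\<And>y. x < y \<Longrightarrow> y < b \<Longrightarrow> \<bar>F y - F x\<bar> < d"
    unfolding eventually_at_right[OF \<open>x < t\<close>] dist_real_def by blast
  have "x < min b t" using b(1) \<open>x < t\<close> by simp
  then obtain f :: "'k \<Rightarrow> real" where f: "continuous_on UNIV f" "antimono f" "\<And>z. f z \<in> {0..1}"
    "\<And>z. z \<le> x \<Longrightarrow> f z = 1" "\<And>z. min b t \<le> z \<Longrightarrow> f z = 0"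
    using Urysohn_antimono[OF compact] by metis
  have near: "F x - d \<le> F r" "F r \<le> F x + d" if "r \<in> {x..<min b t}" for r
    using b(2)[of r] that \<open>0 < d\<close> by (cases "r = x"; force)+
  have "F x - d \<le> J f" "J f \<le> F x + d"
    using near by (auto intro: J_ge[OF f] J_le[OF f])
  then show ?thesis
    using f(1,3,4) by (intro that[of f]) (auto simp: abs_le_iff intro: f(5) min.coboundedI2)
qed

text \<open>At the last point of the line no descending step fits, but there \<open>{..x}\<close> is
  everything and the constant 1 has integral exactly \<open>F x\<close>.\<close>

lemma right_step_exists:
  assumes right_cont: "(F \<longlongrightarrow> F x) (at_right x)" and "0 < d"
  obtains f where "continuous_on UNIV f" "\<And>z. f z \<in> {0..1}" "\<And>z. z \<le> x \<Longrightarrow> f z = 1"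
    "\<bar>J f - F x\<bar> \<le> d"
proof (cases "\<exists>t. x < t")
  case True
  then show ?thesis using narrow_step_exists[OF right_cont _ \<open>0 < d\<close>] that by metis
next
  case False
  then have "{..x} = UNIV" by (auto simp: not_less)
  then have "J (\<lambda>_. 1) = F x"
    by (simp add: signed_integral_def F_eq space_eq)
  with \<open>0 < d\<close> show ?thesis by (intro that[of "\<lambda>_. 1"]) auto
qed

text \<open>The function \<open>h\<close> is a sum of differences of consecutive steps, each signed
  like the corresponding increment of \<open>F\<close>. The invariant
  \<open>\<bar>h z\<bar> \<le> 1 - f z\<close> leaves room for the next difference: adding
  \<open>c * (f z - g z)\<close> yields \<open>1 - g z\<close> as the new bound, so \<open>h\<close>
  never exceeds 1 in absolute value. The error \<open>d\<close> is split into thirds, one for the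
  old chain and one for each of the two steps.\<close>

lemma chain_variation_approx:
  assumes right_cont: "\<And>x. (F \<longlongrightarrow> F x) (at_right x)"
    and "sorted (x # ts)" "0 < d"
  shows "\<exists>f h. continuous_on UNIV f \<and> continuous_on UNIV h \<and> (\<forall>z. f z \<in> {0..1}) \<and>
    (\<forall>z\<le>x. f z = 1) \<and> (\<forall>z. \<bar>h z\<bar> \<le> 1 - f z) \<and> \<bar>J f - F x\<bar> \<le> d \<and>
    chain_variation F (x # ts) \<le> J h + d"
  using assms(2,3)
proof (induction ts arbitrary: x d)
  case Nil
  obtain f where f: "continuous_on UNIV f" "\<And>z. f z \<in> {0..1}" "\<And>z. z \<le> x \<Longrightarrow> f z = 1"
    "\<bar>J f - F x\<bar> \<le> d"
    using right_step_exists[OF right_cont \<open>0 < d\<close>, of x] by metis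
  have "J (\<lambda>_. 0) = 0" by (simp add: signed_integral_def)
  then show ?case
    using f \<open>0 < d\<close> by (intro exI[of _ f] exI[of _ "\<lambda>_. 0"]) auto
next
  case (Cons y ts)
  have "0 < d / 3" using Cons.prems by simp
  moreover have "sorted (y # ts)" using Cons.prems by simp
  ultimately obtain f h where f: "continuous_on UNIV f" "\<And>z. f z \<in> {0..1}"
      "\<And>z. z \<le> y \<Longrightarrow> f z = 1" "\<bar>J f - F y\<bar> \<le> d / 3"
    and h: "continuous_on UNIV h" "\<And>z. \<bar>h z\<bar> \<le> 1 - f z"
      "chain_variation F (y # ts) \<le> J h + d / 3"
    using Cons.IH[of y "d / 3"] by metis
  show ?case
  proof (cases "x = y")
    case True
    then show ?thesis
      using f h Cons.prems(2)
      by (intro exI[of _ f] exI[of _ h]) (auto simp: chain_variation_Cons)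
  next
    case False
    then have "x < y" using Cons.prems by auto
    then obtain g where g: "continuous_on UNIV g" "\<And>z. g z \<in> {0..1}" "\<And>z. z \<le> x \<Longrightarrow> g z = 1"
      "\<And>z. y \<le> z \<Longrightarrow> g z = 0" "\<bar>J g - F x\<bar> \<le> d / 3"
      using narrow_step_exists[OF right_cont _ \<open>0 < d / 3\<close>] by metis
    define c :: real where "c = (if F x \<le> F y then 1 else - 1)"
    have c: "\<bar>c\<bar> = 1" "c * (F y - F x) = \<bar>F y - F x\<bar>" by (auto simp: c_def)
    define h' where "h' z = h z + c * (f z - g z)" for z
    have g_le: "g z \<le> f z" for z
      using f(2)[of z] f(3)[of z] g(2)[of z] g(4)[of z] by (cases "z \<le> y") auto
    have h'_le: "\<bar>h' z\<bar> \<le> 1 - g z" for z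
    proof -
      have "\<bar>h' z\<bar> \<le> \<bar>h z\<bar> + \<bar>c * (f z - g z)\<bar>"
        unfolding h'_def by (rule abs_triangle_ineq)
      also have "\<bar>c * (f z - g z)\<bar> = f z - g z"
        using g_le[of z] by (simp add: abs_mult c(1))
      finally show ?thesis using h(2)[of z] by simp
    qed
    have [measurable]: "f \<in> borel_measurable borel" "g \<in> borel_measurable borel"
      "h \<in> borel_measurable borel"
      using f(1) g(1) h(1) by (auto intro: borel_measurable_continuous_onI)
    have bd: "\<bar>f z\<bar> \<le> 1" "\<bar>g z\<bar> \<le> 1" "\<bar>h z\<bar> \<le> 1" "\<bar>c * (f z - g z)\<bar> \<le> 1" for z
      using f(2)[of z] g(2)[of z] h(2)[of z] g_le[of z] by (auto simp: abs_mult c(1))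
    have "J h' = J h + J (\<lambda>z. c * (f z - g z))"
      unfolding h'_def by (rule J_add[of _ 1 _ 1]) (auto simp: bd)
    also have "J (\<lambda>z. c * (f z - g z)) = c * (J f - J g)"
      unfolding J_scale by (subst J_diff[of _ 1 _ 1]) (auto simp: bd)
    finally have "J h' = J h + c * (J f - J g)" .
    moreover have "c * (J f - J g) \<ge> \<bar>F y - F x\<bar> - 2 * (d / 3)"
      using f(4) g(5) by (auto simp: c_def abs_if split: if_splits)
    ultimately have "chain_variation F (x # y # ts) \<le> J h' + d"
      using h(3) unfolding chain_variation_Cons by linarith
    moreover have "continuous_on UNIV h'"
      unfolding h'_def using f(1) g(1) h(1) by (intro continuous_intros)
    moreover have "\<bar>J g - F x\<bar> \<le> d" using g(5) Cons.prems(2) by linarith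
    ultimately show ?thesis
      using g h'_le by (intro exI[of _ g] exI[of _ h']) auto
  qed
qed

text \<open>Both functions from \<open>chain_variation_approx\<close> are bounded by 1 in absolute
  value, so their integrals are at most \<open>B\<close>; the error \<open>d\<close> is
  arbitrary.\<close>

lemma bounds_from_functional:
  assumes right_cont: "\<And>y. (F \<longlongrightarrow> F y) (at_right y)"
    and B: "\<And>f. continuous_on UNIV f \<Longrightarrow> (\<And>y. \<bar>f y\<bar> \<le> 1) \<Longrightarrow> \<bar>J f\<bar> \<le> B"
  shows bounded_F: "\<And>x. \<bar>F x\<bar> \<le> B"
    and variation_F: "sorted ts \<Longrightarrow> chain_variation F ts \<le> B"
proof -
  have *: "\<bar>F x\<bar> \<le> B + d" "chain_variation F (x # ts) \<le> B + d"
    if st: "sorted (x # ts)" "0 < d" for x ts d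
  proof -
    from chain_variation_approx[OF right_cont st] obtain f h where fh: "continuous_on UNIV f"
      "continuous_on UNIV h" "\<forall>z. f z \<in> {0..1}" "\<forall>z\<le>x. f z = 1" "\<forall>z. \<bar>h z\<bar> \<le> 1 - f z"
      "\<bar>J f - F x\<bar> \<le> d" "chain_variation F (x # ts) \<le> J h + d"
      by (elim exE conjE)
    have le_1: "\<bar>f z\<bar> \<le> 1" "\<bar>h z\<bar> \<le> 1" for z
      using spec[OF fh(3), of z] spec[OF fh(5), of z] by auto
    have "\<bar>J f\<bar> \<le> B" "\<bar>J h\<bar> \<le> B"
      by (intro B fh(1,2) le_1)+
    with fh(6,7) show "\<bar>F x\<bar> \<le> B + d" "chain_variation F (x # ts) \<le> B + d"
      by linarith+
  qed
  show Fx: "\<bar>F x\<bar> \<le> B" for x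
    by (rule field_le_epsilon) (rule *(1)[of _ "[]"], simp_all)
  show "chain_variation F ts \<le> B" if "sorted ts"
  proof (cases ts)
    case Nil
    then show ?thesis using Fx[of undefined] by (simp add: chain_variation_def)
  next
    case (Cons y ys)
    then show ?thesis
      using that by (simp only:) (rule field_le_epsilon, rule *(2))
  qed
qed

text \<open>The distribution function of the sum of \<open>mp\<close> and \<open>mn\<close>
  dominates the increments of \<open>F\<close>. It serves as \<open>v\<close> in
  \<open>type_c0l1_if_separating\<close>.\<close>

lemma F_increment_le:
  assumes "s \<le> t"
  shows "\<bar>F t - F s\<bar> \<le> (measure mp {..t} + measure mn {..t}) - (measure mp {..s} + measure mn {..s})"
proof -
  have "measure mp {..s} \<le> measure mp {..t}" "measure mn {..s} \<le> measure mn {..t}"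
    using assms by (auto intro!: finite_measure.finite_measure_mono[OF fin_p]
        finite_measure.finite_measure_mono[OF fin_n] simp: sets_p sets_n)
  then show ?thesis unfolding F_eq by linarith
qed

end

section \<open>Weak*-null families\<close>

theorem theorem4p9:
  fixes F :: "'i \<Rightarrow> 'k::linorder_topology \<Rightarrow> real"
    and mp mn :: "'i \<Rightarrow> 'k measure"
    and Q :: "'k set"
  assumes "compact (UNIV :: 'k set)"
    and "\<exists>V. countably_separating Q V"
    and "\<forall>i. F i \<in> NBV"
    and "\<forall>i. assoc_measure (F i) (mp i) (mn i)"
    and "weak_star_null F mp mn"
  shows "type_c0l1 F Q"
proof -
  have meas: "compact_line_measure (mp i) (mn i) (F i)" for i
  proof -
    have "radon (mp i)" "radon (mn i)" "F i t = measure (mp i) {..t} - measure (mn i) {..t}" for t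
      using assms(4) by (simp_all add: assoc_measure_def)
    then show ?thesis
      using assms(1)
      by (simp only: compact_line_measure_def compact_line_measure_axioms_def signed_measure_def
          radon_def simp_thms)
  qed
  then have smeas: "signed_measure (mp i) (mn i)" for i
    by (simp add: compact_line_measure_def)
  obtain B where "\<forall>i f. continuous_on UNIV f \<longrightarrow> (\<forall>x. \<bar>f x\<bar> \<le> 1) \<longrightarrow>
    \<bar>signed_integral (mp i) (mn i) f\<bar> \<le> B"
    using weak_star_null_bounded[OF smeas assms(5)] by (elim exE)
  then have B: "\<bar>signed_integral (mp i) (mn i) f\<bar> \<le> B"
    if "continuous_on UNIV f" "\<And>x. \<bar>f x\<bar> \<le> 1" for i f
    using that by simp
  have right_cont: "(F i \<longlongrightarrow> F i x) (at_right x)" for i x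
    using assms(3) by (simp add: NBV_def)
  have bounded: "\<bar>F i t\<bar> \<le> B" for i t
    by (rule compact_line_measure.bounded_F[OF meas right_cont B])
  have variation: "chain_variation (F i) ts \<le> B" if "sorted ts" for i ts
    by (rule compact_line_measure.variation_F[OF meas right_cont B that])
  have avoids: "finite {i. avoids_zero (F i) {s..<t} e}" if "s < t" "0 < e" for s t e
  proof -
    obtain f :: "'k \<Rightarrow> real" where f: "continuous_on UNIV f" "antimono f" "\<And>x. f x \<in> {0..1}"
      "\<And>x. x \<le> s \<Longrightarrow> f x = 1" "\<And>x. t \<le> x \<Longrightarrow> f x = 0"
      using Urysohn_antimono[OF assms(1) \<open>s < t\<close>] by metis
    have "e \<le> \<bar>signed_integral (mp i) (mn i) f\<bar>" if "avoids_zero (F i) {s..<t} e" for i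
      using that unfolding avoids_zero_def
    proof
      assume "\<forall>x\<in>{s..<t}. e \<le> F i x"
      then have "e \<le> signed_integral (mp i) (mn i) f"
        by (intro compact_line_measure.J_ge[OF meas f]) auto
      then show ?thesis by linarith
    next
      assume "\<forall>x\<in>{s..<t}. F i x \<le> - e"
      then have "signed_integral (mp i) (mn i) f \<le> - e"
        by (intro compact_line_measure.J_le[OF meas f]) auto
      then show ?thesis by linarith
    qed
    then have "{i. avoids_zero (F i) {s..<t} e} \<subseteq> {i. e \<le> \<bar>signed_integral (mp i) (mn i) f\<bar>}"
      by blast
    moreover have "finite {i. e \<le> \<bar>signed_integral (mp i) (mn i) f\<bar>}"
      using assms(5) f(1) \<open>0 < e\<close> by (simp add: weak_star_null_def lim_zero_def)
    ultimately show ?thesis by (rule finite_subset)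
  qed
  obtain p :: 'k where p: "\<And>x. p \<le> x"
    using compact_attains_inf[OF assms(1)] by blast
  obtain q :: 'k where q: "\<And>x. x \<le> q"
    using compact_attains_sup[OF assms(1)] by blast
  \<comment> \<open>The least and greatest points are set aside because nothing lies strictly beyond
    them to serve as \<open>l t\<close> or \<open>r t\<close>. They are added back at the end by
    \<open>type_c0l1_insert\<close>.\<close>
  define Q' where "Q' = Q - {p, q}"
  from assms(2) obtain V where
    sepV: "\<forall>x\<in>Q. V x \<subseteq> Q \<and> (\<exists>U. open U \<and> x \<in> U \<and> U \<inter> Q \<subseteq> V x)"
    "\<forall>M. M \<subseteq> Q \<and> (\<forall>x\<in>M. \<forall>y\<in>M. x \<in> V y) \<longrightarrow> countable M"
    unfolding countably_separating_def by (elim exE conjE)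
  \<comment> \<open>The neighbourhoods are shrunk to order intervals. Their end points are taken
    from the whole line and need not lie in \<open>Q\<close>.\<close>
  have "\<exists>a b. a < t \<and> t < b \<and> (\<forall>s\<in>Q'. a < s \<longrightarrow> s < b \<longrightarrow> s \<in> V t)" if "t \<in> Q'" for t
  proof -
    have "t \<in> Q" using that by (simp add: Q'_def)
    then obtain U where U: "open U" "t \<in> U" "U \<inter> Q \<subseteq> V t"
      using bspec[OF sepV(1)] by blast
    have "p < t" "t < q"
      using that p[of t] q[of t] unfolding Q'_def by auto
    obtain a where a: "a < t" "{a<..t} \<subseteq> U"
      using open_left[OF U(1,2) \<open>p < t\<close>] by blast
    obtain b where b: "t < b" "{t..<b} \<subseteq> U"
      using open_right[OF U(1,2) \<open>t < q\<close>] by blast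
    have "s \<in> V t" if "s \<in> Q'" "a < s" "s < b" for s
    proof -
      have "s \<in> {a<..t} \<union> {t..<b}" using that by auto
      then have "s \<in> U" using a b by blast
      then show ?thesis using U(3) that(1) by (auto simp: Q'_def)
    qed
    with a(1) b(1) show ?thesis by blast
  qed
  then have "\<forall>t\<in>Q'. \<exists>a b. a < t \<and> t < b \<and> (\<forall>s\<in>Q'. a < s \<longrightarrow> s < b \<longrightarrow> s \<in> V t)" ..
  then obtain l r where
    "\<forall>t\<in>Q'. l t < t \<and> t < r t \<and> (\<forall>s\<in>Q'. l t < s \<longrightarrow> s < r t \<longrightarrow> s \<in> V t)"
    unfolding bchoice_iff by (elim exE)
  then have lr: "\<And>t. t \<in> Q' \<Longrightarrow> l t < t \<and> t < r t"
    "\<And>s t. s \<in> Q' \<Longrightarrow> t \<in> Q' \<Longrightarrow> l t < s \<Longrightarrow> s < r t \<Longrightarrow> s \<in> V t"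
    by simp_all
  interpret null_family F B Q'
    by unfold_locales (fact bounded variation avoids)+
  have "type_c0l1 F Q'"
  proof (rule type_c0l1_if_separating[OF _ lr])
    show "countable M" if "M \<subseteq> Q'" "\<forall>x\<in>M. \<forall>y\<in>M. x \<in> V y" for M
    proof -
      have "M \<subseteq> Q" using that(1) unfolding Q'_def by blast
      with that(2) show ?thesis using spec[OF sepV(2), of M] by simp
    qed
    show "\<bar>F i t - F i s\<bar> \<le> (measure (mp i) {..t} + measure (mn i) {..t})
        - (measure (mp i) {..s} + measure (mn i) {..s})" if "s \<le> t" for i s t
      by (rule compact_line_measure.F_increment_le[OF meas that])
  qed
  then have "type_c0l1 F (insert q Q')"
    by (rule type_c0l1_insert) (rule bounded)
  then have "type_c0l1 F (insert p (insert q Q'))"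
    by (rule type_c0l1_insert) (rule bounded)
  then show ?thesis
    by (rule type_c0l1_subset) (auto simp: Q'_def)
qed

end
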